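(* Let $\mathbb{K}$ be an algebraically closed field, $V$ a $\mathbb{K}$-vector space of finite positive dimension, and $\Phi=(A;\{E_i\}_{i=0}^d;A^*;\{E_i^*\}_{i=0}^d)$ a TD system on $V$ of diameter $d\geq 1$ that has $q$-Racah type, with fixed associated scalars $q,a,b$. Let the invertible map $\mathcal{M}\in\mathrm{End}(V)$ and the subspaces $U_i,U_i^\Downarrow$ be as defined in the context. Then for $0\leq i\leq d$, $$(\mathcal{M}^{-1}-q^{2i-d}I)U_i\subseteq U_{i-1},\qquad\qquad (\mathcal{M}^{-1}-q^{2i-d}I)U_i^\Downarrow \subseteq U_{i-1}^\Downarrow.$$
   Context: TD pair: an ordered pair of linear maps $A,A^*:V\to V$ such that (i) each is diagonalizable; (ii) there is an ordering $\{V_i\}_{i=0}^d$ of the eigenspaces of $A$ with $A^*V_i\subseteq V_{i-1}+V_i+V_{i+1}$ for $0\le i\le d$ ($V_{-1}=V_{d+1}=0$); (iii) there is an ordering $\{V_i^*\}_{i=0}^\delta$ of the eigenspaces of $A^*$ with $AV_i^*\subseteq V_{i-1}^*+V_i^*+V_{i+1}^*$ for $0\le i\le\delta$ ($V^*_{-1}=V^*_{\delta+1}=0$); (iv) no subspace $W$ with $0\ne W\ne V$ satisfies $AW\subseteq W$ and $A^*W\subseteq W$. It is known that $d=\delta$; $d$ is called the diameter. Orderings as in (ii), (iii) are called standard. The primitive idempotent of $A$ for an eigenspace $V_i$ is the projection of $V$ onto $V_i$ that vanishes on the other eigenspaces (similarly for $A^*$). TD system: $(A;\{E_i\}_{i=0}^d;A^*;\{E_i^*\}_{i=0}^d)$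 where $A,A^*$ is a TD pair and $\{E_i\}$, $\{E_i^*\}$ are the primitive idempotents of $A$, $A^*$, in orders for which the corresponding eigenspace orderings $\{E_iV\}$, $\{E_i^*V\}$ are standard. Let $\theta_i$ (resp. $\theta_i^*$) be the eigenvalue of $A$ on $E_iV$ (resp. of $A^*$ on $E_i^*V$). $\Phi$ has $q$-Racah type if there are nonzero $q,a,b\in\mathbb{K}$ with $q^4\ne1$ and $\theta_i=aq^{d-2i}+a^{-1}q^{2i-d}$, $\theta_i^*=bq^{d-2i}+b^{-1}q^{2i-d}$ for $0\le i\le d$. (Distinctness of eigenvalues forces $q^{2i}\neq1$ for $1\le i\le d$, and $a^2\ne q^{2d-2},q^{2d-4},\dots,q^{2-2d}$; in particular $a^2\neq 1$.) Split decompositions: $U_i=(E_0^*V+\cdots+E_i^*V)\cap(E_iV+\cdots+E_dV)$ and $U_i^\Downarrow=(E_0^*V+\cdots+E_i^*V)\cap(E_0V+\cdots+E_{d-i}V)$ for $0\le i\le d$; $U_{-1}=0$ and $U_{-1}^\Downarrow=0$. It is known that $V=\bigoplus_{i=0}^d U_i=\bigoplus_{i=0}^d U_i^\Downarrow$ with all summands nonzero. $K,B\in\mathrm{End}(V)$ are the linear maps acting on $U_i$, respectively $U_i^\Downarrow$, as the scalar $q^{d-2i}$ ($0\le i\le d$). $\mathcal{M}\in\mathrm{End}(V)$: $\mathcal{M}=\dfrac{aK-a^{-1}B}{a-a^{-1}}$; it is invertible (it is known that $aI-a^{-1}BK^{-1}$ is invertible). *)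

theory Defs
  imports "HOL-Computational_Algebra.Polynomial"
begin

text \<open>
  The vector space \<open>V\<close> is the whole type \<open>'b\<close>, with scalar multiplication \<open>*s\<close>.
  Sequences indexed by \<open>0, \<dots>, d\<close> are functions on \<^typ>\<open>nat\<close> of which only the values
  at indices \<open>\<le> d\<close> matter.
\<close>

text \<open>A separate locale, because \<^locale>\<open>vector_space\<close> is globally interpreted with the real scalars.\<close>

locale td_space = vector_space scale
  for scale :: "'a::field \<Rightarrow> 'b::ab_group_add \<Rightarrow> 'b" (infixr \<open>*s\<close> 75)
begin

abbreviation endomorphism :: "('b \<Rightarrow> 'b) \<Rightarrow> bool" where
  "endomorphism A \<equiv> Vector_Spaces.linear scale scale A"

definition eigenspace :: "('b \<Rightarrow> 'b) \<Rightarrow> 'a \<Rightarrow> 'b set" where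
  "eigenspace A \<theta> = {v. A v = \<theta> *s v}"

definition eigenspaces :: "('b \<Rightarrow> 'b) \<Rightarrow> 'b set set" where
  "eigenspaces A = {eigenspace A \<theta> | \<theta>. eigenspace A \<theta> \<noteq> {0}}"

definition diagonalizable :: "('b \<Rightarrow> 'b) \<Rightarrow> bool" where
  "diagonalizable A \<longleftrightarrow> span (\<Union> (eigenspaces A)) = UNIV"

definition subspace_sum :: "(nat \<Rightarrow> 'b set) \<Rightarrow> nat set \<Rightarrow> 'b set" where
  "subspace_sum W J = span (\<Union>j\<in>J. W j)"

text \<open>
  Intersecting the index set with \<open>{..d}\<close>, together with truncated subtraction, accounts for
  the conventions \<open>V\<^bsub>-1\<^esub> = V\<^bsub>d+1\<^esub> = 0\<close>.
\<close>

definition standard_ordering ::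
    "('b \<Rightarrow> 'b) \<Rightarrow> ('b \<Rightarrow> 'b) \<Rightarrow> nat \<Rightarrow> (nat \<Rightarrow> 'b set) \<Rightarrow> bool" where
  "standard_ordering A A' d W \<longleftrightarrow>
     bij_betw W {..d} (eigenspaces A) \<and>
     (\<forall>i\<le>d. A' ` W i \<subseteq> subspace_sum W ({i - 1..i + 1} \<inter> {..d}))"

definition TD_pair :: "('b \<Rightarrow> 'b) \<Rightarrow> ('b \<Rightarrow> 'b) \<Rightarrow> bool" where
  "TD_pair A As \<longleftrightarrow>
     endomorphism A \<and> endomorphism As \<and>
     diagonalizable A \<and> diagonalizable As \<and>
     (\<exists>d W. standard_ordering A As d W) \<and>
     (\<exists>\<delta> Ws. standard_ordering As A \<delta> Ws) \<and>
     (\<nexists>W. subspace W \<and> W \<noteq> {0} \<and> W \<noteq> UNIV \<and> A ` W \<subseteq> W \<and> As ` W \<subseteq> W)"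

definition primitive_idempotent :: "('b \<Rightarrow> 'b) \<Rightarrow> 'b set \<Rightarrow> ('b \<Rightarrow> 'b) \<Rightarrow> bool" where
  "primitive_idempotent A W E \<longleftrightarrow>
     W \<in> eigenspaces A \<and> endomorphism E \<and> E \<circ> E = E \<and> range E = W \<and>
     (\<forall>W'\<in>eigenspaces A - {W}. \<forall>v\<in>W'. E v = 0)"

definition TD_system ::
    "nat \<Rightarrow> ('b \<Rightarrow> 'b) \<Rightarrow> (nat \<Rightarrow> 'b \<Rightarrow> 'b) \<Rightarrow> ('b \<Rightarrow> 'b) \<Rightarrow> (nat \<Rightarrow> 'b \<Rightarrow> 'b) \<Rightarrow> bool" where
  "TD_system d A E As Es \<longleftrightarrow>
     TD_pair A As \<and>
     (\<forall>i\<le>d. primitive_idempotent A (range (E i)) (E i)) \<and>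
     (\<forall>i\<le>d. primitive_idempotent As (range (Es i)) (Es i)) \<and>
     standard_ordering A As d (\<lambda>i. range (E i)) \<and>
     standard_ordering As A d (\<lambda>i. range (Es i))"

definition q_Racah ::
    "nat \<Rightarrow> ('b \<Rightarrow> 'b) \<Rightarrow> (nat \<Rightarrow> 'b \<Rightarrow> 'b) \<Rightarrow> ('b \<Rightarrow> 'b) \<Rightarrow> (nat \<Rightarrow> 'b \<Rightarrow> 'b) \<Rightarrow>
     'a \<Rightarrow> 'a \<Rightarrow> 'a \<Rightarrow> bool" where
  "q_Racah d A E As Es q a b \<longleftrightarrow>
     q \<noteq> 0 \<and> a \<noteq> 0 \<and> b \<noteq> 0 \<and> q ^ 4 \<noteq> 1 \<and>
     (\<forall>i\<le>d. range (E i) =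
        eigenspace A (a * q powi (int d - 2 * int i) + inverse a * q powi (2 * int i - int d))) \<and>
     (\<forall>i\<le>d. range (Es i) =
        eigenspace As (b * q powi (int d - 2 * int i) + inverse b * q powi (2 * int i - int d)))"

definition split_U ::
    "nat \<Rightarrow> (nat \<Rightarrow> 'b \<Rightarrow> 'b) \<Rightarrow> (nat \<Rightarrow> 'b \<Rightarrow> 'b) \<Rightarrow> nat \<Rightarrow> 'b set" where
  "split_U d E Es i =
     subspace_sum (\<lambda>j. range (Es j)) {0..i} \<inter> subspace_sum (\<lambda>j. range (E j)) {i..d}"

definition split_U_Down ::
    "nat \<Rightarrow> (nat \<Rightarrow> 'b \<Rightarrow> 'b) \<Rightarrow> (nat \<Rightarrow> 'b \<Rightarrow> 'b) \<Rightarrow> nat \<Rightarrow> 'b set" where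
  "split_U_Down d E Es i =
     subspace_sum (\<lambda>j. range (Es j)) {0..i} \<inter> subspace_sum (\<lambda>j. range (E j)) {0..d - i}"

text \<open>Since the \<open>W i\<close> with \<open>i \<le> d\<close> are the summands of a decomposition of \<open>V\<close> in the cases
  of interest, the following determines \<open>X\<close> uniquely.\<close>

definition acts_by_q_weights :: "nat \<Rightarrow> 'a \<Rightarrow> (nat \<Rightarrow> 'b set) \<Rightarrow> ('b \<Rightarrow> 'b) \<Rightarrow> bool" where
  "acts_by_q_weights d q W X \<longleftrightarrow>
     endomorphism X \<and> (\<forall>i\<le>d. \<forall>u\<in>W i. X u = q powi (int d - 2 * int i) *s u)"

definition M_map :: "'a \<Rightarrow> ('b \<Rightarrow> 'b) \<Rightarrow> ('b \<Rightarrow> 'b) \<Rightarrow> 'b \<Rightarrow> 'b" where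
  "M_map a K B v = inverse (a - inverse a) *s (a *s K v - inverse a *s B v)"

end

text \<open>The term \<open>W\<^bsub>i-1\<^esub>\<close> of a sequence of subspaces, with \<open>W\<^bsub>-1\<^esub> = 0\<close>.\<close>

definition pred_term :: "(nat \<Rightarrow> 'b::zero set) \<Rightarrow> nat \<Rightarrow> 'b set" where
  "pred_term W i = (if i = 0 then {0} else W (i - 1))"

end

theory Submission
  imports Defs
begin

text \<open>
  Write \<open>p = q\<^sup>2\<close>, \<open>c = a - a\<^sup>-\<^sup>1\<close>, \<open>F\<^sub>i = E\<^sup>*\<^sub>0V + \<dots> + E\<^sup>*\<^sub>iV\<close>. The claim amounts to the relation
  \<open>K \<M>\<^sup>-\<^sup>1 - p \<M>\<^sup>-\<^sup>1 K = (1 - p) I\<close> and the same relation for \<open>B\<close>, that is, to the vanishing of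
  \<open>Q = \<M> K - p K \<M> - (1 - p) \<M>\<^sup>2\<close>. The split decompositions give \<open>q\<close>-commutation relations of
  \<open>A\<close> and \<open>A\<^sup>*\<close> with \<open>K\<close> and \<open>B\<close>, hence with \<open>\<M>\<close> and with \<open>Q\<close>; they show that the smallest
  subspace containing the image of \<open>Q\<close> and stable under \<open>K\<close> and \<open>\<M>\<close> is also stable under \<open>A\<close> and
  \<open>A\<^sup>*\<close>. Since \<open>K\<close> and \<open>\<M>\<close> are triangular for the flag \<open>F\<close> with the same diagonal, this subspace
  lies in \<open>F\<^bsub>d-1\<^esub> \<noteq> V\<close>, so it is \<open>0\<close> by irreducibility.
\<close>

subsection \<open>Linear algebra\<close>

context td_space begin

lemma endo_simps:
  assumes "endomorphism f"
  shows "f (x + y) = f x + f y" "f (x - y) = f x - f y" "f (c *s x) = c *s f x" "f (- x) = - f x" "f 0 = 0"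
proof -
  interpret f: Vector_Spaces.linear scale scale f by fact
  show "f (x + y) = f x + f y" "f (x - y) = f x - f y" "f (c *s x) = c *s f x" "f (- x) = - f x" "f 0 = 0"
    by (rule f.add f.diff f.scale f.neg f.zero)+
qed

lemma endomorphism_shift: "endomorphism f \<Longrightarrow> endomorphism (\<lambda>v. f v - c *s v)"
  by (simp add: Vector_Spaces.linear_iff vector_space_axioms algebra_simps)

lemma endomorphism_span:
  assumes "endomorphism f" "x \<in> span S" "subspace T" "\<And>x. x \<in> S \<Longrightarrow> f x \<in> T"
  shows "f x \<in> T"
  using assms(2)
  by (induction rule: span_induct_alt)
    (use assms in \<open>auto simp: endo_simps[OF assms(1)] subspace_add subspace_scale subspace_0\<close>)

text \<open>Linearity is assumed as equations rather than as \<open>endomorphism\<close>, so that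
  both sides of an operator identity can be plugged in as compound terms and the side conditions
  left to simplification.\<close>

lemma endomorphisms_eq_on_span:
  assumes "x \<in> span S" "\<And>x. x \<in> S \<Longrightarrow> f x = g x"
    and "\<And>x y. f (x + y) = f x + f y" "\<And>c x. f (c *s x) = c *s f x"
    and "\<And>x y. g (x + y) = g x + g y" "\<And>c x. g (c *s x) = c *s g x"
  shows "f x = g x"
  using assms(1)
proof (induction rule: span_induct_alt)
  case base
  show ?case using assms(4)[of 0 0] assms(6)[of 0 0] by simp
qed (use assms in auto)

lemma subspace_subspace_sum: "subspace (subspace_sum W J)"
  by (simp add: subspace_sum_def)

lemma subspace_sum_mono: "J \<subseteq> J' \<Longrightarrow> subspace_sum W J \<subseteq> subspace_sum W J'"
  unfolding subspace_sum_def by (intro span_mono) blast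

lemma subspace_sum_base: "j \<in> J \<Longrightarrow> v \<in> W j \<Longrightarrow> v \<in> subspace_sum W J"
  unfolding subspace_sum_def by (intro span_base) blast

lemma subspace_sum_empty [simp]: "subspace_sum W {} = {0}"
  by (simp add: subspace_sum_def)

lemma subspace_pred_term: "(\<And>i. subspace (W i)) \<Longrightarrow> subspace (pred_term W i)"
  by (simp add: pred_term_def)

subsection \<open>Commutation identities\<close>

text \<open>The next two identities come from expanding both sides in words in \<open>K\<close> and \<open>M\<close>; the
  coefficients on the right were found by comparing those expansions.\<close>

lemma defect_commutation_A:
  fixes K M A Q :: "'b \<Rightarrow> 'b"
  assumes lin: "endomorphism A" "endomorphism K" "endomorphism M"
    and KA: "\<And>v. p *s K (A v) = A (K v) + (p - 1) *s (a *s K (K v) + a' *s v)"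
    and MA: "\<And>v. p *s M (A v) = A (M v) + (p - 1) *s (a *s (K (M v) + M (K v)) - c *s M (M v))"
  defines "Q \<equiv> \<lambda>v. M (K v) - p *s K (M v) - (1 - p) *s M (M v)"
  shows "A (Q v) = (p * p) *s Q (A v) - (p - 1) *s ((a * (1 + p)) *s (Q (K v) + K (Q v))
           + ((1 - p) * a - c) *s M (Q v) - (p * c + (1 - p) * a) *s Q (M v))"
proof -
  note simps = lin[THEN endo_simps(1)] lin[THEN endo_simps(2)] lin[THEN endo_simps(3)]
  \<comment> \<open>Solved for \<open>A (K v)\<close> and \<open>A (M v)\<close>, the hypotheses
    become rewrite rules that move \<open>A\<close> to the innermost position.\<close>
  have AK: "A (K v) = p *s K (A v) - (p - 1) *s (a *s K (K v) + a' *s v)" for v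
    using KA[of v] by simp
  have AM: "A (M v) = p *s M (A v) - (p - 1) *s (a *s (K (M v) + M (K v)) - c *s M (M v))" for v
    using MA[of v] by simp
  show ?thesis unfolding Q_def
    by (simp add: simps AK AM algebra_simps)
qed

lemma defect_commutation_As:
  fixes K M As Q :: "'b \<Rightarrow> 'b"
  assumes lin: "endomorphism As" "endomorphism K" "endomorphism M"
    and AK: "\<And>v. p *s As (K v) = K (As v) + (p - 1) *s (b *s K (K v) + b' *s v)"
    and AM: "\<And>v. p *s As (M v) = M (As v)
      + (p - 1) *s (b *s (f *s (K (M v) + M (K v) - K (K v)) - (f - 1) *s M (M v)) + b' *s v)"
  defines "Q \<equiv> \<lambda>v. M (K v) - p *s K (M v) - (1 - p) *s M (M v)"
  shows "(p * p) *s As (Q v) = Q (As v) + ((p - 1) * b) *s ((p * (1 + f)) *s K (Q v) + (1 + f) *s Q (K v)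
           + (1 - p * f) *s M (Q v) + (p - f) *s Q (M v))"
proof -
  note simps = lin[THEN endo_simps(1)] lin[THEN endo_simps(2)] lin[THEN endo_simps(3)]
  \<comment> \<open>These rules move \<open>As\<close> outermost instead; with the factor
    \<open>p * p\<close> on the left of the goal no division by \<open>p\<close> occurs.\<close>
  have KA: "K (As v) = p *s As (K v) - (p - 1) *s (b *s K (K v) + b' *s v)" for v
    using AK[of v] by simp
  have MA: "M (As v) = p *s As (M v)
      - (p - 1) *s (b *s (f *s (K (M v) + M (K v) - K (K v)) - (f - 1) *s M (M v)) + b' *s v)" for v
    using AM[of v] by simp
  show ?thesis unfolding Q_def
    by (simp add: simps KA MA algebra_simps)
qed

section \<open>Relations inherited by the combination M of K and B\<close>

lemma scaled_combination_apply:
  fixes f K B M :: "'b \<Rightarrow> 'b"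
  assumes "\<And>v. c *s M v = a *s K v - a' *s B v" "endomorphism f"
  shows "c *s f (M v) = a *s f (K v) - a' *s f (B v)"
  using assms(1)[of v] endo_simps(2,3)[OF assms(2)] by metis

lemma scaled_combination_square:
  fixes K B M :: "'b \<Rightarrow> 'b"
  assumes "endomorphism M" and M: "\<And>v. c *s M v = a *s K v - a' *s B v"
  shows "c *s c *s M (M v) = a *s (a *s K (K v) - a' *s B (K v)) - a' *s (a *s K (B v) - a' *s B (B v))"
  using scaled_combination_apply[where f = M and M = M, OF M assms(1), of v] M[of "K v"] M[of "B v"]
  by (simp add: scale_right_diff_distrib scale_left_commute[of c] del: scale_scale)

text \<open>Subtracting \<open>a'\<close> times the relation for \<open>B\<close> from
  \<open>a\<close> times that for \<open>K\<close> cancels the constant terms and leaves X^2 - Y^2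
  with X = aK, Y = a'B. Since X - Y = cM, this equals X(cM) + (cM)X - (cM)^2; one factor
  \<open>c\<close> is then cancelled.\<close>

lemma combination_commutation_A:
  fixes K B M A :: "'b \<Rightarrow> 'b"
  assumes lin: "endomorphism A" "endomorphism K" "endomorphism B" "endomorphism M"
    and M: "\<And>v. c *s M v = a *s K v - a' *s B v" and c: "c \<noteq> 0"
    and KA: "\<And>v. p *s K (A v) = A (K v) + (p - 1) *s (a *s K (K v) + a' *s v)"
    and BA: "\<And>v. p *s B (A v) = A (B v) + (p - 1) *s (a' *s B (B v) + a *s v)"
  shows "p *s M (A v) = A (M v) + (p - 1) *s (a *s (K (M v) + M (K v)) - c *s M (M v))"
proof -
  note simps = lin[THEN endo_simps(1)] lin[THEN endo_simps(2)] lin[THEN endo_simps(3)]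
  have AK: "A (K v) = p *s K (A v) - (p - 1) *s (a *s K (K v) + a' *s v)" for v
    using KA[of v] by simp
  have AB: "A (B v) = p *s B (A v) - (p - 1) *s (a' *s B (B v) + a *s v)" for v
    using BA[of v] by simp
  note push = scaled_combination_apply[of c M a K a' B, OF M]
  note MM = scaled_combination_square[OF lin(4) M]
  have "c *s (p *s M (A v)) = p *s (a *s K (A v) - a' *s B (A v))"
    by (simp only: M[symmetric] scale_left_commute[of c])
  also have "\<dots> = (a *s A (K v) - a' *s A (B v))
      + (p - 1) *s (a *s (a *s K (K v) - a' *s K (B v) + (a *s K (K v) - a' *s B (K v)))
      - (a *s (a *s K (K v) - a' *s B (K v)) - a' *s (a *s K (B v) - a' *s B (B v))))"
    by (simp add: AK AB algebra_simps)
  also have "\<dots> = c *s A (M v) + (p - 1) *s (a *s (c *s K (M v) + c *s M (K v)) - c *s c *s M (M v))"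
    by (simp only: MM push[OF lin(1), of v] push[OF lin(2), of v] M[of "K v"])
  also have "\<dots> = c *s (A (M v) + (p - 1) *s (a *s (K (M v) + M (K v)) - c *s M (M v)))"
    by (simp add: algebra_simps)
  finally show ?thesis using c by (simp only: scale_cancel_left simp_thms)
qed

text \<open>With X = aK, Y = a'B and aa' = 1, the quadratic part aK^2 - a'B^2 is a'X^2 - aY^2.
  Substituting Y = X - cM turns it into -cX^2 + a(X(cM) + (cM)X) - a(cM)^2. The constant terms add
  up to \<open>c *s b' *s v\<close>, so \<open>c\<close> cancels throughout.\<close>

lemma combination_commutation_As:
  fixes K B M As :: "'b \<Rightarrow> 'b"
  assumes lin: "endomorphism As" "endomorphism K" "endomorphism B" "endomorphism M"
    and M: "\<And>v. c *s M v = a *s K v - a' *s B v" and c: "c = a - a'" "c \<noteq> 0" and aa: "a * a' = 1"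
    and AK: "\<And>v. p *s As (K v) = K (As v) + (p - 1) *s (b *s K (K v) + b' *s v)"
    and AB: "\<And>v. p *s As (B v) = B (As v) + (p - 1) *s (b *s B (B v) + b' *s v)"
  shows "p *s As (M v) = M (As v)
      + (p - 1) *s (b *s (a\<^sup>2 *s (K (M v) + M (K v) - K (K v)) - (a\<^sup>2 - 1) *s M (M v)) + b' *s v)"
proof -
  note simps = lin[THEN endo_simps(1)] lin[THEN endo_simps(2)] lin[THEN endo_simps(3)]
  note push = scaled_combination_apply[of c M a K a' B, OF M]
  note MM = scaled_combination_square[OF lin(4) M]
  have ac: "a\<^sup>2 - 1 = a * c" unfolding c(1) using aa by (simp add: algebra_simps power2_eq_square)
  have aa': "a * (a' * z) = z" for z using aa by (metis mult.assoc mult_1)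
  have "c *s (p *s As (M v)) = p *s (a *s As (K v) - a' *s As (B v))"
    by (simp only: push[OF lin(1)] scale_left_commute[of c])
  also have "\<dots> = a *s (p *s As (K v)) - a' *s (p *s As (B v))" by (simp add: algebra_simps)
  also have "\<dots> = (a *s K (As v) - a' *s B (As v))
      + (p - 1) *s (b *s (a\<^sup>2 *s ((a *s K (K v) - a' *s K (B v)) + (a *s K (K v) - a' *s B (K v))
      - (a - a') *s K (K v))
      - a *s (a *s (a *s K (K v) - a' *s B (K v)) - a' *s (a *s K (B v) - a' *s B (B v)))) + (a - a') *s b' *s v)"
    by (simp add: AK AB algebra_simps aa' power2_eq_square)
  also have "\<dots> = c *s M (As v)
      + (p - 1) *s (b *s (a\<^sup>2 *s (c *s K (M v) + c *s M (K v) - c *s K (K v)) - a *s c *s c *s M (M v)) + c *s b' *s v)"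
    by (simp only: MM push[OF lin(2), of v] M[of "K v"] M[of "As v"] c(1)[symmetric])
  also have "\<dots> = c *s (M (As v)
      + (p - 1) *s (b *s (a\<^sup>2 *s (K (M v) + M (K v) - K (K v)) - (a\<^sup>2 - 1) *s M (M v)) + b' *s v))"
    unfolding ac by (simp add: algebra_simps)
  finally show ?thesis using c by (simp only: scale_cancel_left simp_thms)
qed

end

subsection \<open>Split decompositions\<close>

text \<open>The enumeration \<open>V\<close> is a parameter so that both split decompositions are
  instances: the second one comes from the reversed order of the eigenspaces of \<open>A\<close>,
  with \<open>Vs\<close> unchanged.\<close>

locale td_split = td_space scale
  for scale :: "'a::field \<Rightarrow> 'b::ab_group_add \<Rightarrow> 'b" (infixr \<open>*s\<close> 75) +
  fixes d :: nat and A As :: "'b \<Rightarrow> 'b" and V Vs :: "nat \<Rightarrow> 'b set" and \<theta> \<theta>s :: "nat \<Rightarrow> 'a"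
  assumes lin_A: "endomorphism A" and lin_As: "endomorphism As"
    and V_eig: "i \<le> d \<Longrightarrow> v \<in> V i \<Longrightarrow> A v = \<theta> i *s v"
    and Vs_eig: "i \<le> d \<Longrightarrow> v \<in> Vs i \<Longrightarrow> As v = \<theta>s i *s v"
    and V_tri: "i \<le> d \<Longrightarrow> v \<in> V i \<Longrightarrow> As v \<in> subspace_sum V ({i - 1..i + 1} \<inter> {..d})"
    and Vs_tri: "i \<le> d \<Longrightarrow> v \<in> Vs i \<Longrightarrow> A v \<in> subspace_sum Vs ({i - 1..i + 1} \<inter> {..d})"
    and V_sum: "subspace_sum V {0..d} = UNIV"
    and Vs_sum: "subspace_sum Vs {0..d} = UNIV"
    and Vs_proper: "subspace_sum Vs {0..<d} \<noteq> UNIV"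
    and Vs_0: "\<exists>v\<in>Vs 0. v \<noteq> 0"
    and d_pos: "0 < d"
    and irreducible: "subspace W \<Longrightarrow> A ` W \<subseteq> W \<Longrightarrow> As ` W \<subseteq> W \<Longrightarrow> W = {0} \<or> W = UNIV"
begin

abbreviation "F i \<equiv> subspace_sum Vs {0..i}"
abbreviation "G i \<equiv> subspace_sum V {i..d}"
abbreviation "U i \<equiv> F i \<inter> G i"

section \<open>Action on the two flags and on the split decomposition\<close>

lemma F_proper: "F (d - 1) \<noteq> UNIV"
proof -
  have "{0..d - 1} = {0..<d}" using d_pos by auto
  then show ?thesis using Vs_proper by simp
qed

lemma A_F:
  assumes "i < d" "v \<in> F i"
  shows "A v \<in> F (Suc i)"
proof (rule endomorphism_span[OF lin_A assms(2)[unfolded subspace_sum_def] subspace_subspace_sum])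
  fix x assume "x \<in> (\<Union>j\<in>{0..i}. Vs j)"
  then obtain j where j: "j \<le> i" "x \<in> Vs j" by auto
  then have "A x \<in> subspace_sum Vs ({j - 1..j + 1} \<inter> {..d})" using assms by (intro Vs_tri) auto
  then show "A x \<in> F (Suc i)"
    by (rule subsetD[OF subspace_sum_mono, rotated]) (use j in auto)
qed

lemma As_G:
  assumes "v \<in> G i"
  shows "As v \<in> G (i - 1)"
proof (rule endomorphism_span[OF lin_As assms[unfolded subspace_sum_def] subspace_subspace_sum])
  fix x assume "x \<in> (\<Union>j\<in>{i..d}. V j)"
  then obtain j where j: "i \<le> j" "j \<le> d" "x \<in> V j" by auto
  then have "As x \<in> subspace_sum V ({j - 1..j + 1} \<inter> {..d})" by (intro V_tri) auto
  then show "As x \<in> G (i - 1)"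
    by (rule subsetD[OF subspace_sum_mono, rotated]) (use j in auto)
qed

lemma A_G:
  assumes "v \<in> G i"
  shows "A v - \<theta> i *s v \<in> G (Suc i)"
proof (rule endomorphism_span[OF endomorphism_shift[OF lin_A] assms[unfolded subspace_sum_def]
      subspace_subspace_sum])
  fix x assume "x \<in> (\<Union>j\<in>{i..d}. V j)"
  then obtain j where j: "i \<le> j" "j \<le> d" "x \<in> V j" by auto
  then have Ax: "A x - \<theta> i *s x = (\<theta> j - \<theta> i) *s x" by (simp add: V_eig scale_left_diff_distrib)
  show "A x - \<theta> i *s x \<in> G (Suc i)"
  proof (cases "j = i")
    case True
    then show ?thesis unfolding Ax by (simp add: subspace_0[OF subspace_subspace_sum])
  next
    case False
    then show ?thesis unfolding Ax using j
      by (intro subspace_scale[OF subspace_subspace_sum] subspace_sum_base[of j]) auto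
  qed
qed

lemma As_F:
  assumes "i \<le> d" "v \<in> F i"
  shows "As v - \<theta>s i *s v \<in> pred_term F i"
proof (rule endomorphism_span[OF endomorphism_shift[OF lin_As] assms(2)[unfolded subspace_sum_def]
      subspace_pred_term[OF subspace_subspace_sum]])
  fix x assume "x \<in> (\<Union>j\<in>{0..i}. Vs j)"
  then obtain j where j: "j \<le> i" "x \<in> Vs j" by auto
  then have Ax: "As x - \<theta>s i *s x = (\<theta>s j - \<theta>s i) *s x"
    using assms by (simp add: Vs_eig scale_left_diff_distrib)
  show "As x - \<theta>s i *s x \<in> pred_term F i"
  proof (cases "j = i")
    case True
    then show ?thesis unfolding Ax
      by (simp add: subspace_0[OF subspace_pred_term[OF subspace_subspace_sum]])
  next
    case False
    then have "(\<theta>s j - \<theta>s i) *s x \<in> F (i - 1)" using j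
      by (intro subspace_scale[OF subspace_subspace_sum] subspace_sum_base[of j]) auto
    then show ?thesis unfolding Ax using False j by (simp add: pred_term_def)
  qed
qed

lemma subspace_U: "subspace (U i)"
  by (intro subspace_inter subspace_subspace_sum)

lemma pred_term_U: "v \<in> pred_term F i \<Longrightarrow> v \<in> G (i - 1) \<Longrightarrow> v \<in> pred_term U i"
  by (auto simp: pred_term_def split: if_splits)

text \<open>For \<open>k = 0\<close> this subspace contains \<open>E\<^sup>*\<^sub>0V\<close>, hence is \<open>V\<close>; for \<open>k = 1\<close> it lies in \<open>F\<^bsub>d-1\<^esub>\<close>, hence
  is \<open>0\<close>. Together these give the split decomposition.\<close>

lemma shifted_invariant:
  fixes k :: nat
  defines "W \<equiv> span (\<Union>i\<le>d. F i \<inter> G (i + k))"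
  shows "W = {0} \<or> W = UNIV"
proof (rule irreducible)
  show sub: "subspace W" by (simp add: W_def)
  have base: "v \<in> W" if "i \<le> d" "v \<in> F i" "v \<in> G (i + k)" for v i
    unfolding W_def using that by (intro span_base) auto
  have "A v \<in> W" if "v \<in> W" for v
  proof (rule endomorphism_span[OF lin_A that[unfolded W_def] sub])
    fix x assume "x \<in> (\<Union>i\<le>d. F i \<inter> G (i + k))"
    then obtain i where i: "i \<le> d" "x \<in> F i" "x \<in> G (i + k)" by auto
    let ?r = "A x - \<theta> (i + k) *s x"
    \<comment> \<open>\<open>A\<close> minus its eigenvalue raises both indices by one, so the
      offset \<open>k\<close> between them is preserved.\<close>
    have G: "?r \<in> G (Suc i + k)" using A_G[OF i(3)] by simp
    have "?r \<in> W"
    proof (cases "i < d")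
      case True
      have "x \<in> F (Suc i)" using i(2) subspace_sum_mono[of "{0..i}" "{0..Suc i}" Vs] by auto
      then have "?r \<in> F (Suc i)"
        by (intro subspace_diff[OF subspace_subspace_sum] subspace_scale[OF subspace_subspace_sum]
            A_F[OF True i(2)])
      then show ?thesis using G True by (intro base[of "Suc i"]) auto
    next
      case False
      \<comment> \<open>For \<open>i = d\<close> the index \<open>Suc i + k\<close> exceeds
        \<open>d\<close>, so \<open>G\<close> is an empty sum and the remainder is 0.\<close>
      then show ?thesis using G i(1) subspace_0[OF sub] by simp
    qed
    moreover have "\<theta> (i + k) *s x \<in> W" using base[OF i] sub by (rule subspace_scale[rotated])
    ultimately have "?r + \<theta> (i + k) *s x \<in> W" by (rule subspace_add[OF sub])
    then show "A x \<in> W" by simp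
  qed
  then show "A ` W \<subseteq> W" by blast
  have "As v \<in> W" if "v \<in> W" for v
  proof (rule endomorphism_span[OF lin_As that[unfolded W_def] sub])
    fix x assume "x \<in> (\<Union>i\<le>d. F i \<inter> G (i + k))"
    then obtain i where i: "i \<le> d" "x \<in> F i" "x \<in> G (i + k)" by auto
    let ?r = "As x - \<theta>s i *s x"
    have F: "?r \<in> pred_term F i" by (rule As_F[OF i(1,2)])
    have "?r \<in> W"
    proof (cases "i = 0")
      case True
      then show ?thesis using F subspace_0[OF sub] by (simp add: pred_term_def)
    next
      case False
      have "x \<in> G (i + k - 1)" using i(3) subspace_sum_mono[of "{i + k..d}" "{i + k - 1..d}" V] by auto
      then have "?r \<in> G (i + k - 1)"
        by (intro subspace_diff[OF subspace_subspace_sum] subspace_scale[OF subspace_subspace_sum]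
            As_G[OF i(3)])
      then show ?thesis using F False i(1) by (intro base[of "i - 1"]) (auto simp: pred_term_def)
    qed
    moreover have "\<theta>s i *s x \<in> W" using base[OF i] sub by (rule subspace_scale[rotated])
    ultimately have "?r + \<theta>s i *s x \<in> W" by (rule subspace_add[OF sub])
    then show "As x \<in> W" by simp
  qed
  then show "As ` W \<subseteq> W" by blast
qed

lemma span_U: "span (\<Union>i\<le>d. U i) = UNIV"
proof -
  obtain v where v: "v \<in> Vs 0" "v \<noteq> 0" using Vs_0 by blast
  then have "v \<in> U 0" using V_sum by (auto intro!: subspace_sum_base[of 0])
  then have "v \<in> span (\<Union>i\<le>d. U i)" by (intro span_base UN_I[of 0]) auto
  then show ?thesis using v shifted_invariant[of 0] by auto
qed

lemma F_Int_G:
  assumes "i \<le> d" "v \<in> F i" "v \<in> G (Suc i)"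
  shows "v = 0"
proof -
  have "F j \<inter> G (j + 1) \<subseteq> F (d - 1)" if "j \<le> d" for j
  proof (cases "j = d")
    case True
    then show ?thesis by (auto simp: subspace_0[OF subspace_subspace_sum])
  next
    case False
    then have "{0..j} \<subseteq> {0..d - 1}" using that by auto
    then show ?thesis using subspace_sum_mono by blast
  qed
  then have "span (\<Union>j\<le>d. F j \<inter> G (j + 1)) \<subseteq> F (d - 1)"
    by (intro span_minimal subspace_subspace_sum) blast
  then have "span (\<Union>j\<le>d. F j \<inter> G (j + 1)) = {0}"
    using F_proper shifted_invariant[of 1] by auto
  moreover have "v \<in> span (\<Union>j\<le>d. F j \<inter> G (j + 1))"
    using assms by (intro span_base) auto
  ultimately show ?thesis by blast
qed

text \<open>Splitting \<open>v\<close> along all the \<open>U j\<close>, the part with indices above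
  \<open>i\<close> lies in \<open>G (Suc i)\<close>, and also in \<open>F i\<close> as a difference
  of two elements of \<open>F i\<close>; by \<open>F_Int_G\<close> it is 0.\<close>

lemma F_subset_span_U:
  assumes "i \<le> d"
  shows "F i \<subseteq> span (\<Union>j\<le>i. U j)"
proof
  fix v assume v: "v \<in> F i"
  have "{..d} = {..i} \<union> {Suc i..d}" using assms by auto
  then have "(\<Union>j\<le>d. U j) = (\<Union>j\<le>i. U j) \<union> (\<Union>j\<in>{Suc i..d}. U j)" by auto
  then have "v \<in> span ((\<Union>j\<le>i. U j) \<union> (\<Union>j\<in>{Suc i..d}. U j))" using span_U by auto
  then obtain x y where xy: "v = x + y" "x \<in> span (\<Union>j\<le>i. U j)" "y \<in> span (\<Union>j\<in>{Suc i..d}. U j)"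
    unfolding span_Un by blast
  have "(\<Union>j\<le>i. U j) \<subseteq> F i" using subspace_sum_mono[of "{0.._}" "{0..i}" Vs] by fastforce
  then have "x \<in> F i" using xy(2) span_minimal[OF _ subspace_subspace_sum] by blast
  then have "y \<in> F i" using v xy(1) subspace_diff[OF subspace_subspace_sum, of v Vs "{0..i}" x] by simp
  moreover have "(\<Union>j\<in>{Suc i..d}. U j) \<subseteq> G (Suc i)"
    using subspace_sum_mono[of "{_..d}" "{Suc i..d}" V] by fastforce
  then have "y \<in> G (Suc i)" using xy(3) span_minimal[OF _ subspace_subspace_sum] by blast
  ultimately have "y = 0" using F_Int_G assms by blast
  then show "v \<in> span (\<Union>j\<le>i. U j)" using xy by simp
qed

lemma A_U:
  assumes "i \<le> d" "v \<in> U i"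
  shows "i < d \<Longrightarrow> A v - \<theta> i *s v \<in> U (Suc i)" "i = d \<Longrightarrow> A v = \<theta> i *s v"
proof -
  have G: "A v - \<theta> i *s v \<in> G (Suc i)" using A_G assms by blast
  show "A v = \<theta> i *s v" if "i = d" using G that by simp
  assume "i < d"
  have "v \<in> F (Suc i)" using assms(2) subspace_sum_mono[of "{0..i}" "{0..Suc i}" Vs] by auto
  then have "A v - \<theta> i *s v \<in> F (Suc i)" using assms(2)
    by (intro subspace_diff[OF subspace_subspace_sum] subspace_scale[OF subspace_subspace_sum]
            A_F[OF \<open>i < d\<close>]) auto
  with G show "A v - \<theta> i *s v \<in> U (Suc i)" by blast
qed

lemma As_U:
  assumes "i \<le> d" "v \<in> U i"
  shows "As v - \<theta>s i *s v \<in> pred_term U i"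
proof (rule pred_term_U)
  show "As v - \<theta>s i *s v \<in> pred_term F i" using As_F assms by blast
  have "v \<in> G (i - 1)" using assms(2) subspace_sum_mono[of "{i..d}" "{i - 1..d}" V] by auto
  then show "As v - \<theta>s i *s v \<in> G (i - 1)" using assms(2)
    by (intro subspace_diff[OF subspace_subspace_sum] subspace_scale[OF subspace_subspace_sum]
            As_G) auto
qed

end

text \<open>The weights model q^(d-2i) with p = q^2. The last two assumptions are \<theta> = a \<mu>
  + a' / \<mu> and its analogue for \<open>As\<close>, cleared of denominators so that they turn
  into quadratic expressions in \<open>K\<close>.\<close>

locale td_split_weight = td_split scale d A As V Vs \<theta> \<theta>s
  for scale :: "'a::field \<Rightarrow> 'b::ab_group_add \<Rightarrow> 'b" (infixr \<open>*s\<close> 75)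
    and d A As V Vs \<theta> \<theta>s +
  fixes K :: "'b \<Rightarrow> 'b" and \<mu> :: "nat \<Rightarrow> 'a" and p a a' b b' :: 'a
  assumes lin_K: "endomorphism K"
    and K_U: "i \<le> d \<Longrightarrow> u \<in> U i \<Longrightarrow> K u = \<mu> i *s u"
    and weight_ratio: "i < d \<Longrightarrow> \<mu> i = p * \<mu> (Suc i)"
    and weight_nonzero: "i \<le> d \<Longrightarrow> \<mu> i \<noteq> 0"
    and weight_inj: "inj_on \<mu> {..d}"
    and \<theta>_weight: "i \<le> d \<Longrightarrow> \<theta> i * \<mu> i = a * (\<mu> i * \<mu> i) + a'"
    and \<theta>s_weight: "i \<le> d \<Longrightarrow> \<theta>s i * \<mu> i = b * (\<mu> i * \<mu> i) + b'"
begin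

lemma eq_on_U:
  assumes "\<And>i u. i \<le> d \<Longrightarrow> u \<in> U i \<Longrightarrow> f u = g u"
    and "\<And>x y. f (x + y) = f x + f y" "\<And>c x. f (c *s x) = c *s f x"
    and "\<And>x y. g (x + y) = g x + g y" "\<And>c x. g (c *s x) = c *s g x"
  shows "f v = g v"
  by (rule endomorphisms_eq_on_span[of v "\<Union>i\<le>d. U i"]) (use assms span_U in auto)

lemmas map_simps = endo_simps[OF lin_A] endo_simps[OF lin_As] endo_simps[OF lin_K]

text \<open>On \<open>U i\<close>, \<open>A\<close> is a scalar plus a raising part
  \<open>r\<close>. Raising divides the weight by \<open>p\<close>, so \<open>r\<close> drops out of
  pKA - AK, and the scalar part gives (p - 1) times \<theta> \<mu> = a \<mu>^2 + a'.\<close>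

lemma K_A: "p *s K (A v) = A (K v) + (p - 1) *s (a *s K (K v) + a' *s v)"
proof (rule eq_on_U[where f = "\<lambda>v. p *s K (A v)"])
  fix i u assume i: "i \<le> d" and u: "u \<in> U i"
  define r where "r = A u - \<theta> i *s u"
  have Au: "A u = \<theta> i *s u + r" by (simp add: r_def)
  have Ku: "K u = \<mu> i *s u" using K_U i u .
  have Kr: "p *s K r = \<mu> i *s r"
  proof (cases "i < d")
    case True
    then have "K r = \<mu> (Suc i) *s r" using A_U(1)[OF i u] K_U[of "Suc i" r] by (simp add: r_def)
    then show ?thesis using weight_ratio[OF True] by simp
  next
    case False
    then have "r = 0" using A_U(2)[OF i u] i by (simp add: r_def)
    then show ?thesis by (simp add: map_simps)
  qed
  have weight: "(\<theta> i * \<mu> i) *s u = a *s K (K u) + a' *s u"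
    by (simp only: \<theta>_weight[OF i] Ku map_simps scale_left_distrib scale_scale mult.assoc)
  have "p *s K (A u) = (p * (\<theta> i * \<mu> i)) *s u + \<mu> i *s r"
    by (simp add: Au Ku Kr map_simps scale_right_distrib)
  also have "\<dots> = A (K u) + (p - 1) *s ((\<theta> i * \<mu> i) *s u)"
    by (simp add: Ku Au map_simps algebra_simps)
  finally show "p *s K (A u) = A (K u) + (p - 1) *s (a *s K (K u) + a' *s u)" unfolding weight .
qed (simp_all add: map_simps algebra_simps)

text \<open>Dual to \<open>K_A\<close>: the remainder \<open>r\<close> is now lowering, which
  multiplies the weight by \<open>p\<close>, so it cancels in the opposite order of the two
  factors.\<close>

lemma As_K: "p *s As (K v) = K (As v) + (p - 1) *s (b *s K (K v) + b' *s v)"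
proof (rule eq_on_U[where f = "\<lambda>v. p *s As (K v)"])
  fix i u assume i: "i \<le> d" and u: "u \<in> U i"
  define r where "r = As u - \<theta>s i *s u"
  have Au: "As u = \<theta>s i *s u + r" by (simp add: r_def)
  have Ku: "K u = \<mu> i *s u" using K_U i u .
  have Kr: "K r = p *s \<mu> i *s r"
  proof (cases "i = 0")
    case True
    then have "r = 0" using As_U[OF i u] by (simp add: r_def pred_term_def)
    then show ?thesis by (simp add: map_simps)
  next
    case False
    then have "K r = \<mu> (i - 1) *s r" using As_U[OF i u] K_U[of "i - 1" r] i by (simp add: r_def pred_term_def)
    then show ?thesis using weight_ratio[of "i - 1"] False i by simp
  qed
  have weight: "(\<theta>s i * \<mu> i) *s u = b *s K (K u) + b' *s u"
    by (simp only: \<theta>s_weight[OF i] Ku map_simps scale_left_distrib scale_scale mult.assoc)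
  have "p *s As (K u) = K (As u) + (p - 1) *s ((\<theta>s i * \<mu> i) *s u)"
    by (simp add: Ku Au Kr map_simps algebra_simps)
  then show "p *s As (K u) = K (As u) + (p - 1) *s (b *s K (K u) + b' *s u)" unfolding weight .
qed (simp_all add: map_simps algebra_simps)

lemma K_F:
  assumes i: "i \<le> d" and v: "v \<in> F i"
  shows "K v - \<mu> i *s v \<in> pred_term F i"
proof (rule endomorphism_span[OF endomorphism_shift[OF lin_K] subsetD[OF F_subset_span_U[OF i] v]
      subspace_pred_term[OF subspace_subspace_sum]])
  fix x assume "x \<in> (\<Union>j\<le>i. U j)"
  then obtain j where j: "j \<le> i" "x \<in> U j" by auto
  then have Kx: "K x - \<mu> i *s x = (\<mu> j - \<mu> i) *s x"
    using i K_U[of j x] by (simp add: scale_left_diff_distrib)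
  show "K x - \<mu> i *s x \<in> pred_term F i"
  proof (cases "j = i")
    case True
    then show ?thesis unfolding Kx
      by (simp add: subspace_0[OF subspace_pred_term[OF subspace_subspace_sum]])
  next
    case False
    then have "{0..j} \<subseteq> {0..i - 1}" using j by auto
    then have "x \<in> F (i - 1)" using j(2) subspace_sum_mono by blast
    then show ?thesis unfolding Kx using False j
      by (simp add: pred_term_def subspace_scale[OF subspace_subspace_sum])
  qed
qed

text \<open>The other summands are eliminated one at a time: \<open>K\<close> minus
  \<open>\<mu> k\<close> kills \<open>U k\<close>, preserves the remaining summands, and multiplies
  \<open>w\<close> by the nonzero scalar \<open>\<mu> j - \<mu> k\<close>.\<close>

lemma K_eigenvector:
  assumes "j \<le> d" "K w = \<mu> j *s w"
  shows "w \<in> U j"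
proof -
  have "w \<in> span (\<Union>i\<in>J \<union> {j}. U i) \<Longrightarrow> w \<in> span (\<Union>i\<in>{j}. U i)"
    if "finite J" "J \<subseteq> {..d} - {j}" for J
    using that
  proof (induction J rule: finite_induct)
    case (insert k J)
    have "K w - \<mu> k *s w \<in> span (\<Union>i\<in>J \<union> {j}. U i)"
    proof (rule endomorphism_span[OF endomorphism_shift[OF lin_K] insert.prems(1)])
      fix x assume "x \<in> (\<Union>i\<in>insert k J \<union> {j}. U i)"
      then obtain i where i: "i \<in> insert k J \<union> {j}" "x \<in> U i" by blast
      then have Kx: "K x - \<mu> k *s x = (\<mu> i - \<mu> k) *s x"
        using K_U[of i x] insert.prems(2) assms(1) by (auto simp: scale_left_diff_distrib)
      show "K x - \<mu> k *s x \<in> span (\<Union>i\<in>J \<union> {j}. U i)"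
      proof (cases "i = k")
        case True
        then show ?thesis unfolding Kx by (simp add: span_zero)
      next
        case False
        then show ?thesis unfolding Kx using i by (intro span_scale span_base) auto
      qed
    qed simp
    moreover have "K w - \<mu> k *s w = (\<mu> j - \<mu> k) *s w"
      by (simp add: assms scale_left_diff_distrib)
    moreover have "\<mu> j - \<mu> k \<noteq> 0"
      using insert.prems(2) assms(1) weight_inj by (auto dest: inj_onD)
    ultimately have "w \<in> span (\<Union>i\<in>J \<union> {j}. U i)"
      using span_scale[of "(\<mu> j - \<mu> k) *s w" _ "inverse (\<mu> j - \<mu> k)"] by simp
    then show ?case using insert by auto
  qed simp
  from this[of "{..d} - {j}"] have "w \<in> span (U j)"
    using span_U assms(1) by (simp add: insert_absorb)
  then show ?thesis using span_minimal[OF _ subspace_U] by blast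
qed

text \<open>In operator form the hypothesis on \<open>X\<close> says that \<open>D = X - K\<^sup>-\<^sup>1\<close> satisfies \<open>K D = p D K\<close>, so \<open>D\<close>
  multiplies the weights of \<open>K\<close> by \<open>p\<close>. Since \<open>p \<mu>\<^sub>0\<close> may coincide with \<open>\<mu>\<^sub>d\<close>, the case \<open>i = 0\<close> needs
  a separate hypothesis.\<close>

lemma lowering_of_commutation:
  assumes "endomorphism X" "\<And>v. K (X v) = p *s X (K v) + (1 - p) *s v"
    and "\<And>u. u \<in> U 0 \<Longrightarrow> X u = inverse (\<mu> 0) *s u"
    and i: "i \<le> d" and u: "u \<in> U i"
  shows "X u - inverse (\<mu> i) *s u \<in> pred_term U i"
proof (cases "i = 0")
  case True
  then show ?thesis using assms by (simp add: pred_term_def)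
next
  case False
  have Ku: "K u = \<mu> i *s u" using K_U i u .
  have nz: "\<mu> i \<noteq> 0" using weight_nonzero i .
  have ratio: "\<mu> (i - 1) = p * \<mu> i" using weight_ratio[of "i - 1"] False i by simp
  \<comment> \<open>The difference turns out to be an eigenvector of \<open>K\<close> for
    \<open>p * \<mu> i\<close>, the weight of \<open>U (i - 1)\<close>.\<close>
  have "K (X u - inverse (\<mu> i) *s u) = (p * \<mu> i) *s X u + (1 - p) *s u - u"
    using nz by (simp add: map_simps assms(2) Ku endo_simps[OF assms(1)])
  also have "\<dots> = (p * \<mu> i) *s (X u - inverse (\<mu> i) *s u)"
    using nz by (simp add: algebra_simps)
  finally have "X u - inverse (\<mu> i) *s u \<in> U (i - 1)"
    unfolding ratio[symmetric] using i by (intro K_eigenvector) auto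
  then show ?thesis using False by (simp add: pred_term_def)
qed

end

subsection \<open>The relation between \<open>K\<close>, \<open>B\<close> and \<open>\<M>\<close>\<close>

text \<open>The inductive form lets stability under \<open>A\<close> and \<open>As\<close> be proved
  by rule induction, moving these maps past one letter \<open>K\<close> or \<open>M\<close> at a
  time.\<close>

inductive_set (in td_space) invariant_hull :: "('b \<Rightarrow> 'b) \<Rightarrow> ('b \<Rightarrow> 'b) \<Rightarrow> 'b set \<Rightarrow> 'b set"
  for K M :: "'b \<Rightarrow> 'b" and S :: "'b set" where
  gen: "x \<in> S \<Longrightarrow> x \<in> invariant_hull K M S"
| zero: "0 \<in> invariant_hull K M S"
| add: "x \<in> invariant_hull K M S \<Longrightarrow> y \<in> invariant_hull K M S \<Longrightarrow> x + y \<in> invariant_hull K M S"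
| scale: "x \<in> invariant_hull K M S \<Longrightarrow> c *s x \<in> invariant_hull K M S"
| apply_K: "x \<in> invariant_hull K M S \<Longrightarrow> K x \<in> invariant_hull K M S"
| apply_M: "x \<in> invariant_hull K M S \<Longrightarrow> M x \<in> invariant_hull K M S"

text \<open>Both halves share \<open>Vs\<close>, hence the flag \<open>F\<close>, and the weights;
  reversing the eigenspaces of \<open>A\<close> exchanges \<open>a\<close> and
  \<open>a'\<close>.\<close>

locale td_split_pair =
  td_split_weight scale d A As V Vs \<theta> \<theta>s K \<mu> p a a' b b' +
  down: td_split_weight scale d A As V' Vs \<theta>' \<theta>s B \<mu> p a' a b b'
  for scale :: "'a::field \<Rightarrow> 'b::ab_group_add \<Rightarrow> 'b" (infixr \<open>*s\<close> 75)
    and d A As V V' Vs \<theta> \<theta>' \<theta>s K B \<mu> p a a' b b' +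
  fixes M :: "'b \<Rightarrow> 'b" and c :: 'a
  assumes lin_M: "endomorphism M"
    and c_M: "c *s M v = a *s K v - a' *s B v"
    and c_eq: "c = a - a'" and c_nonzero: "c \<noteq> 0" and a_inverse: "a * a' = 1" and p_nonzero: "p \<noteq> 0"
begin

section \<open>Triangularity and invertibility of M\<close>

lemma M_F:
  assumes "i \<le> d" "v \<in> F i"
  shows "M v - \<mu> i *s v \<in> pred_term F i"
proof -
  have sub: "subspace (pred_term F i)" by (intro subspace_pred_term subspace_subspace_sum)
  have "c *s (M v - \<mu> i *s v) = a *s (K v - \<mu> i *s v) - a' *s (B v - \<mu> i *s v)"
    by (simp add: scale_right_diff_distrib c_M) (simp add: c_eq algebra_simps)
  also have "\<dots> \<in> pred_term F i"
    using K_F[OF assms] down.K_F[OF assms] by (blast intro: subspace_diff[OF sub] subspace_scale[OF sub])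
  finally have "inverse c *s c *s (M v - \<mu> i *s v) \<in> pred_term F i" by (rule subspace_scale[OF sub])
  then show ?thesis using c_nonzero by simp
qed

text \<open>\<open>M\<close> is triangular on the flag with nonzero diagonal entries: a kernel
  vector in \<open>F (Suc i)\<close> is a multiple of \<open>M v - \<mu> (Suc i) *s v\<close> and so
  drops into \<open>F i\<close>.\<close>

lemma M_triangular_inj: "i \<le> d \<Longrightarrow> v \<in> F i \<Longrightarrow> M v = 0 \<Longrightarrow> v = 0"
proof (induction i)
  case 0
  then show ?case using M_F[of 0 v] weight_nonzero[of 0] by (simp add: pred_term_def)
next
  case (Suc i)
  have "M v - \<mu> (Suc i) *s v \<in> F i" using M_F[OF Suc.prems(1,2)] by (simp add: pred_term_def)
  then have "- inverse (\<mu> (Suc i)) *s (M v - \<mu> (Suc i) *s v) \<in> F i"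
    by (rule subspace_scale[OF subspace_subspace_sum])
  then have "v \<in> F i" using Suc.prems weight_nonzero[of "Suc i"] by simp
  then show ?case using Suc by simp
qed

lemma M_triangular_surj: "i \<le> d \<Longrightarrow> v \<in> F i \<Longrightarrow> v \<in> range M"
proof (induction i arbitrary: v)
  case 0
  then have "v = M (inverse (\<mu> 0) *s v)"
    using M_F[of 0 v] weight_nonzero[of 0] by (simp add: pred_term_def endo_simps[OF lin_M])
  then show ?case by blast
next
  case (Suc i)
  have "M v - \<mu> (Suc i) *s v \<in> F i" using M_F[OF Suc.prems] by (simp add: pred_term_def)
  then obtain u where "M v - \<mu> (Suc i) *s v = M u" using Suc by force
  then have "\<mu> (Suc i) *s v = M (v - u)" by (simp add: endo_simps[OF lin_M] algebra_simps)
  then have "v = M (inverse (\<mu> (Suc i)) *s (v - u))"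
    using weight_nonzero[OF Suc.prems(1)] by (simp add: endo_simps(3)[OF lin_M] flip: \<open>_ = M (v - u)\<close>)
  then show ?case by blast
qed

lemma bij_M: "bij M"
proof (rule bijI)
  show "inj M"
  proof (rule injI)
    fix x y assume "M x = M y"
    then have "M (x - y) = 0" by (simp add: endo_simps[OF lin_M])
    then show "x = y" using M_triangular_inj[of d "x - y"] Vs_sum by simp
  qed
  show "surj M" using M_triangular_surj[of d] Vs_sum by auto
qed

section \<open>Vanishing of the defect Q\<close>

abbreviation "Q v \<equiv> M (K v) - p *s K (M v) - (1 - p) *s M (M v)"

lemma K_M_F_invariant:
  assumes "v \<in> F i" "i \<le> d"
  shows "K v \<in> F i" "M v \<in> F i"
proof -
  note sub = subspace_subspace_sum
  have "pred_term F i \<subseteq> F i"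
    using subspace_sum_mono[of "{0..i - 1}" "{0..i}" Vs] by (auto simp: pred_term_def subspace_0[OF sub])
  then have "K v - \<mu> i *s v \<in> F i" "M v - \<mu> i *s v \<in> F i"
    using K_F M_F assms by blast+
  then have "K v - \<mu> i *s v + \<mu> i *s v \<in> F i" "M v - \<mu> i *s v + \<mu> i *s v \<in> F i"
    using assms(1) by (blast intro: subspace_add[OF sub] subspace_scale[OF sub])+
  then show "K v \<in> F i" "M v \<in> F i" by simp_all
qed

text \<open>Modulo \<open>F (d - 1)\<close> both \<open>K\<close> and \<open>M\<close> are the
  scalar m = \<open>\<mu> d\<close>, so \<open>Q\<close> is m^2 - p m^2 - (1 - p) m^2 = 0.\<close>

lemma range_Q: "Q v \<in> F (d - 1)"
proof -
  note sub = subspace_subspace_sum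
  define k m where "k = K v - \<mu> d *s v" and "m = M v - \<mu> d *s v"
  have km: "K v = \<mu> d *s v + k" "M v = \<mu> d *s v + m" by (simp_all add: k_def m_def)
  have "k \<in> F (d - 1)" "m \<in> F (d - 1)"
    unfolding k_def m_def using K_F[of d v] M_F[of d v] d_pos Vs_sum by (simp_all add: pred_term_def)
  moreover have "Q v = \<mu> d *s m + M k - (p * \<mu> d) *s k - p *s K m - ((1 - p) * \<mu> d) *s m - (1 - p) *s M m"
    by (simp add: km map_simps endo_simps[OF lin_M] algebra_simps)
  ultimately show ?thesis
    by (simp only:) (intro subspace_diff[OF sub] subspace_add[OF sub] subspace_scale[OF sub]
        K_M_F_invariant; simp)
qed

lemma Q_eq_0: "Q v = 0"
proof -
  let ?W = "invariant_hull K M (range (\<lambda>v. Q v))"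
  note W = invariant_hull.intros[where K = K and M = M]
  have sub: "subspace ?W" by (rule subspaceI) (rule W; assumption)+
  have Q: "Q v \<in> ?W" for v by (rule W(1)) blast
  note W_intros = Q W(5,6) subspace_diff[OF sub] subspace_add[OF sub] subspace_scale[OF sub]
  have A_M: "p *s M (A v) = A (M v) + (p - 1) *s (a *s (K (M v) + M (K v)) - c *s M (M v))" for v
    by (rule combination_commutation_A[OF lin_A lin_K down.lin_K lin_M c_M c_nonzero K_A down.K_A])
  have As_M: "p *s As (M v) = M (As v)
      + (p - 1) *s (b *s (a\<^sup>2 *s (K (M v) + M (K v) - K (K v)) - (a\<^sup>2 - 1) *s M (M v)) + b' *s v)" for v
    by (rule combination_commutation_As[OF lin_As lin_K down.lin_K lin_M c_M c_eq c_nonzero a_inverse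
          As_K down.As_K])
  have "A x \<in> ?W" if "x \<in> ?W" for x
    using that
  proof induction
    case (gen x)
    then obtain v where "x = Q v" by blast
    then show ?case
      \<comment> \<open>The right-hand side consists of values of \<open>Q\<close> with at most one
        further \<open>K\<close> or \<open>M\<close> applied, all in the hull.\<close>
      by (simp only: defect_commutation_A[OF lin_A lin_K lin_M K_A A_M]) (intro W_intros)
  next
    case (apply_K x)
    have "A (K x) = p *s K (A x) - (p - 1) *s (a *s K (K x) + a' *s x)" by (simp add: K_A)
    also have "\<dots> \<in> ?W" using apply_K by (intro W_intros)
    finally show ?case .
  next
    case (apply_M x)
    have "A (M x) = p *s M (A x) - (p - 1) *s (a *s (K (M x) + M (K x)) - c *s M (M x))" by (simp add: A_M)
    also have "\<dots> \<in> ?W" using apply_M by (intro W_intros)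
    finally show ?case .
  next
    case zero
    show ?case by (simp add: map_simps W(2))
  next
    case (add x y)
    then show ?case by (simp add: map_simps W(3))
  next
    case (scale x c)
    then show ?case by (simp add: map_simps W(4))
  qed
  moreover have "As x \<in> ?W" if "x \<in> ?W" for x
  proof -
    \<comment> \<open>The relations for \<open>As\<close> only give \<open>p\<close> or
      \<open>p * p\<close> times the wanted vector, so these factors are divided out.\<close>
    have cancel: "y \<in> ?W" if "p *s y \<in> ?W" for y
      using subspace_scale[OF sub that, of "inverse p"] p_nonzero by simp
    show ?thesis using that
    proof induction
      case (gen x)
      then obtain v where x: "x = Q v" by blast
      have "p *s p *s As x \<in> ?W"
        unfolding x scale_scale
        by (simp only: defect_commutation_As[OF lin_As lin_K lin_M As_K As_M]) (intro W_intros)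
      then show ?case by (rule cancel[OF cancel])
    next
      case (apply_K x)
      then have "p *s As (K x) \<in> ?W" unfolding As_K by (intro W_intros)
      then show ?case by (rule cancel)
    next
      case (apply_M x)
      then have "p *s As (M x) \<in> ?W" unfolding As_M by (intro W_intros)
      then show ?case by (rule cancel)
    next
      case zero
      show ?case by (simp add: map_simps W(2))
    next
      case (add x y)
      then show ?case by (simp add: map_simps W(3))
    next
      case (scale x c)
      then show ?case by (simp add: map_simps W(4))
    qed
  qed
  ultimately have "?W = {0} \<or> ?W = UNIV" by (intro irreducible[OF sub]) auto
  \<comment> \<open>\<open>F (d - 1)\<close> contains the generators and is stable under
    \<open>K\<close> and \<open>M\<close>, which rules out that the hull is all of
    \<open>V\<close>.\<close>
  moreover have "x \<in> F (d - 1)" if "x \<in> ?W" for x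
    using that
  proof induction
    case (gen x)
    then show ?case using range_Q by blast
  qed (simp_all add: subspace_0 subspace_add subspace_scale subspace_subspace_sum K_M_F_invariant)
  ultimately have "?W = {0}" using F_proper by blast
  then show ?thesis using Q by blast
qed

section \<open>Commutation relations and lowering for the inverse of M\<close>

lemma M_K: "M (K v) = p *s K (M v) + (1 - p) *s M (M v)"
  using Q_eq_0[of v] by (simp add: algebra_simps)

text \<open>Substituting a'B = aK - cM into \<open>M_K\<close>, the leftover multiple of M^2 is (a -
  c)(1 - p), and a - c = a' restores the same form.\<close>

lemma M_B: "M (B v) = p *s B (M v) + (1 - p) *s M (M v)"
proof -
  have a'_B: "a' *s B w = a *s K w - c *s M w" for w by (simp add: c_M)
  have "a' *s M (B v) = a *s M (K v) - c *s M (M v)"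
    using endo_simps(2,3)[OF lin_M] a'_B[of v] by metis
  also have "\<dots> = p *s (a *s K (M v) - c *s M (M v)) + ((a - c) * (1 - p)) *s M (M v)"
    by (simp add: M_K algebra_simps)
  also have "\<dots> = a' *s (p *s B (M v) + (1 - p) *s M (M v))"
    unfolding a'_B[symmetric] by (simp add: c_eq algebra_simps)
  finally show ?thesis using a_inverse by auto
qed

lemma M_inv: "M (inv M v) = v"
  by (rule surj_f_inv_f[OF bij_is_surj[OF bij_M]])

lemma inv_M: "inv M (M v) = v"
  by (rule inv_f_f[OF bij_is_inj[OF bij_M]])

lemma lin_inv_M: "endomorphism (inv M)"
proof -
  have "inv M (x + y) = inv M x + inv M y" for x y
    using inv_M[of "inv M x + inv M y"] by (simp add: endo_simps[OF lin_M] M_inv)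
  moreover have "inv M (k *s x) = k *s inv M x" for k x
    using inv_M[of "k *s inv M x"] by (simp add: endo_simps[OF lin_M] M_inv)
  ultimately show ?thesis by (simp add: Vector_Spaces.linear_iff vector_space_axioms)
qed

text \<open>The assumed relation is multiplied by the inverse of \<open>M\<close> on both
  sides.\<close>

lemma inv_M_commutation:
  assumes "\<And>v. M (T v) = p *s T (M v) + (1 - p) *s M (M v)"
  shows "T (inv M v) = p *s inv M (T v) + (1 - p) *s v"
  using inv_M[of "T (inv M v)"] by (simp add: assms M_inv inv_M endo_simps[OF lin_inv_M])

text \<open>This supplies the case \<open>i = 0\<close> of the lowering argument for both
  decompositions, whose bottom terms lie in \<open>F 0\<close>.\<close>

lemma inv_M_F0: "v \<in> F 0 \<Longrightarrow> inv M v = inverse (\<mu> 0) *s v"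
proof -
  assume "v \<in> F 0"
  then have "v = M (inverse (\<mu> 0) *s v)"
    using M_F[of 0 v] weight_nonzero[of 0] by (simp add: pred_term_def endo_simps[OF lin_M])
  then show ?thesis by (metis inv_M)
qed

lemma inv_M_lowers:
  assumes "i \<le> d"
  shows "u \<in> U i \<Longrightarrow> inv M u - inverse (\<mu> i) *s u \<in> pred_term U i"
    and "u \<in> down.U i \<Longrightarrow> inv M u - inverse (\<mu> i) *s u \<in> pred_term down.U i"
  using assms inv_M_F0
  by (auto intro!: lowering_of_commutation down.lowering_of_commutation lin_inv_M
      inv_M_commutation M_K M_B)

end

subsection \<open>Application to tridiagonal systems\<close>

context td_space begin

lemma eigenvalues_distinct:
  assumes "standard_ordering A A' d W" "\<And>i. i \<le> d \<Longrightarrow> W i = eigenspace A (\<theta> i)"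
  shows "inj_on \<theta> {..d}"
proof (rule inj_onI)
  fix i j assume ij: "i \<in> {..d}" "j \<in> {..d}" "\<theta> i = \<theta> j"
  then have "W i = W j" by (simp add: assms(2))
  moreover have "inj_on W {..d}" using assms(1) by (simp add: standard_ordering_def bij_betw_def)
  ultimately show "i = j" using ij(1,2) by (blast dest: inj_onD)
qed

lemma standard_ordering_sum:
  assumes "standard_ordering A A' d W" "diagonalizable A"
  shows "subspace_sum W {0..d} = UNIV"
proof -
  have "W ` {..d} = eigenspaces A"
    using assms(1) by (simp add: standard_ordering_def bij_betw_def)
  then show ?thesis
    using assms(2) by (simp add: diagonalizable_def subspace_sum_def atLeast0AtMost)
qed

text \<open>The two split decompositions differ by the reversal of the ordering of the eigenspaces of
  \<^term>\<open>A\<close>.\<close>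

lemma standard_ordering_rev:
  assumes "standard_ordering A A' d W"
  shows "standard_ordering A A' d (\<lambda>i. W (d - i))"
proof -
  have rev: "bij_betw (\<lambda>i. d - i) {..d} {..d}"
    by (rule bij_betw_byWitness[where f' = "\<lambda>i. d - i"]) auto
  have sum_rev: "subspace_sum W ({d - i - 1..d - i + 1} \<inter> {..d})
      \<subseteq> subspace_sum (\<lambda>i. W (d - i)) ({i - 1..i + 1} \<inter> {..d})" if "i \<le> d" for i
    unfolding subspace_sum_def
  proof (intro span_mono UN_least)
    fix j assume "j \<in> {d - i - 1..d - i + 1} \<inter> {..d}"
    then have *: "d - j \<in> {i - 1..i + 1} \<inter> {..d}" "d - (d - j) = j" using that by auto
    have "W (d - (d - j)) \<subseteq> (\<Union>k\<in>{i - 1..i + 1} \<inter> {..d}. W (d - k))"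
      by (rule UN_upper) (fact *(1))
    then show "W j \<subseteq> (\<Union>k\<in>{i - 1..i + 1} \<inter> {..d}. W (d - k))"
      by (simp only: *(2))
  qed
  show ?thesis
    unfolding standard_ordering_def
  proof (intro conjI allI impI)
    show "bij_betw (\<lambda>i. W (d - i)) {..d} (eigenspaces A)"
      using bij_betw_trans[OF rev conjunct1[OF assms[unfolded standard_ordering_def]]]
      by (simp add: comp_def)
    fix i assume i: "i \<le> d"
    have "A' ` W (d - i) \<subseteq> subspace_sum W ({d - i - 1..d - i + 1} \<inter> {..d})"
      by (rule assms[unfolded standard_ordering_def, THEN conjunct2, rule_format]) simp
    then show "A' ` W (d - i) \<subseteq> subspace_sum (\<lambda>i. W (d - i)) ({i - 1..i + 1} \<inter> {..d})"
      using sum_rev[OF i] by (rule order_trans)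
  qed
qed

text \<open>\<open>E d\<close> vanishes on the other eigenspaces; if these spanned \<open>V\<close>,
  its range would be 0, which is not in \<open>eigenspaces A\<close>.\<close>

lemma primitive_idempotents_proper:
  assumes prim: "\<And>i. i \<le> d \<Longrightarrow> primitive_idempotent A (range (E i)) (E i)"
    and ord: "standard_ordering A A' d (\<lambda>i. range (E i))"
  shows "subspace_sum (\<lambda>i. range (E i)) {0..<d} \<noteq> UNIV"
proof
  assume *: "subspace_sum (\<lambda>i. range (E i)) {0..<d} = UNIV"
  have lin: "endomorphism (E d)" using prim[of d] by (simp add: primitive_idempotent_def)
  have "E d v \<in> {0}" for v
  proof (rule endomorphism_span[OF lin])
    show "v \<in> span (\<Union>j\<in>{0..<d}. range (E j))" using * by (simp add: subspace_sum_def)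
    fix x assume "x \<in> (\<Union>j\<in>{0..<d}. range (E j))"
    then obtain j where j: "j < d" "x \<in> range (E j)" by auto
    have "inj_on (\<lambda>i. range (E i)) {..d}"
      using ord unfolding standard_ordering_def by (blast dest: bij_betw_imp_inj_on)
    then have "range (E j) \<noteq> range (E d)" using j(1) unfolding inj_on_def by force
    moreover have "range (E j) \<in> eigenspaces A"
      using prim[of j] j(1) unfolding primitive_idempotent_def by simp
    ultimately have "E d x = 0"
      using prim[of d] j(2) unfolding primitive_idempotent_def by blast
    then show "E d x \<in> {0}" by simp
  qed simp
  then have "range (E d) = {0}" by auto
  moreover have "range (E d) \<in> eigenspaces A"
    using prim[of d] unfolding primitive_idempotent_def by simp
  ultimately show False unfolding eigenspaces_def by blast
qed

lemma td_split_of_TD_pair: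
  assumes TD: "TD_pair A As"
    and ord: "standard_ordering A As d V" and ord_s: "standard_ordering As A d Vs"
    and V: "\<And>i. i \<le> d \<Longrightarrow> V i = eigenspace A (\<theta> i)"
    and Vs: "\<And>i. i \<le> d \<Longrightarrow> Vs i = eigenspace As (\<theta>s i)"
    and proper: "subspace_sum Vs {0..<d} \<noteq> UNIV" and d: "0 < d"
  shows "td_split scale d A As V Vs \<theta> \<theta>s"
proof (intro td_split.intro td_split_axioms.intro td_space_axioms)
  show "endomorphism A" "endomorphism As" using TD by (simp_all add: TD_pair_def)
  show "A v = \<theta> i *s v" if "i \<le> d" "v \<in> V i" for i v using that V by (simp add: eigenspace_def)
  show "As v = \<theta>s i *s v" if "i \<le> d" "v \<in> Vs i" for i v using that Vs by (simp add: eigenspace_def)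
  show "As v \<in> subspace_sum V ({i - 1..i + 1} \<inter> {..d})" if "i \<le> d" "v \<in> V i" for i v
    using ord that unfolding standard_ordering_def by blast
  show "A v \<in> subspace_sum Vs ({i - 1..i + 1} \<inter> {..d})" if "i \<le> d" "v \<in> Vs i" for i v
    using ord_s that unfolding standard_ordering_def by blast
  show "subspace_sum V {0..d} = UNIV" "subspace_sum Vs {0..d} = UNIV"
    using TD standard_ordering_sum[OF ord] standard_ordering_sum[OF ord_s] by (simp_all add: TD_pair_def)
  show "subspace_sum Vs {0..<d} \<noteq> UNIV" "0 < d" by (fact proper d)+
  show "W = {0} \<or> W = UNIV" if "subspace W" "A ` W \<subseteq> W" "As ` W \<subseteq> W" for W
    using TD that unfolding TD_pair_def by blast
  have "Vs 0 \<in> eigenspaces As"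
    using ord_s by (auto simp: standard_ordering_def dest: bij_betw_apply)
  \<comment> \<open>Together with \<open>Vs 0\<close> not being \<open>{0}\<close>, this yields a
    nonzero vector.\<close>
  moreover have "0 \<in> Vs 0"
    using Vs[of 0] endo_simps(5)[OF \<open>endomorphism As\<close>] by (simp add: eigenspace_def)
  ultimately show "\<exists>v\<in>Vs 0. v \<noteq> 0" by (auto simp: eigenspaces_def)
qed

end

theorem lemma10p2:
  fixes scale :: "'k::alg_closed_field \<Rightarrow> 'v::ab_group_add \<Rightarrow> 'v"
    and Basis :: "'v set"
    and A As K B :: "'v \<Rightarrow> 'v"
    and E Es :: "nat \<Rightarrow> 'v \<Rightarrow> 'v"
    and q a b :: 'k
    and d i :: nat
  assumes "finite_dimensional_vector_space scale Basis"
    and "vector_space.dim scale (UNIV :: 'v set) > 0"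
    and "td_space.TD_system scale d A E As Es"
    and "d \<ge> 1"
    and "td_space.q_Racah scale d A E As Es q a b"
    and "td_space.acts_by_q_weights scale d q (td_space.split_U scale d E Es) K"
    and "td_space.acts_by_q_weights scale d q (td_space.split_U_Down scale d E Es) B"
    and "i \<le> d"
  shows "(\<lambda>v. inv (td_space.M_map scale a K B) v - scale (q powi (2 * int i - int d)) v)
           ` td_space.split_U scale d E Es i
         \<subseteq> pred_term (td_space.split_U scale d E Es) i \<and>
         (\<lambda>v. inv (td_space.M_map scale a K B) v - scale (q powi (2 * int i - int d)) v)
           ` td_space.split_U_Down scale d E Es i
         \<subseteq> pred_term (td_space.split_U_Down scale d E Es) i"
proof -
  interpret td_space scale
    using assms(1) by (simp add: td_space_def finite_dimensional_vector_space_def)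
  note TD = assms(3)[unfolded TD_system_def] and Racah = assms(5)[unfolded q_Racah_def]
    and K = assms(6)[unfolded acts_by_q_weights_def] and B = assms(7)[unfolded acts_by_q_weights_def]
  define \<mu> where "\<mu> j = q powi (int d - 2 * int j)" for j
  define \<theta> where "\<theta> j = a * \<mu> j + inverse a * inverse (\<mu> j)" for j
  define \<theta>s where "\<theta>s j = b * \<mu> j + inverse b * inverse (\<mu> j)" for j
  define \<theta>d where "\<theta>d j = inverse a * \<mu> j + a * inverse (\<mu> j)" for j
  define V where "V j = range (E j)" for j
  define Vd where "Vd j = V (d - j)" for j
  define Vs where "Vs j = range (Es j)" for j
  let ?M = "M_map a K B"
  have nz: "q \<noteq> 0" "a \<noteq> 0" "b \<noteq> 0" using Racah by auto
  have \<mu>_nz: "\<mu> j \<noteq> 0" for j using nz by (simp add: \<mu>_def)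
  have \<mu>_inv: "inverse (\<mu> j) = q powi (2 * int j - int d)" for j
    by (simp add: \<mu>_def flip: power_int_minus)
  have V_eig: "V j = eigenspace A (\<theta> j)" if "j \<le> d" for j
    using Racah that by (simp add: V_def \<theta>_def \<mu>_inv) (simp add: \<mu>_def)
  have Vs_eig: "Vs j = eigenspace As (\<theta>s j)" if "j \<le> d" for j
    using Racah that by (simp add: Vs_def \<theta>s_def \<mu>_inv) (simp add: \<mu>_def)
  have \<mu>_rev: "\<mu> (d - j) = inverse (\<mu> j)" if "j \<le> d" for j
    unfolding \<mu>_inv using that by (simp add: \<mu>_def of_nat_diff algebra_simps)
  have Vd_eig: "Vd j = eigenspace A (\<theta>d j)" if "j \<le> d" for j
    using V_eig[of "d - j"] that by (simp add: Vd_def \<theta>_def \<theta>d_def \<mu>_rev add.commute)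
  have ord: "standard_ordering A As d V" and ord_s: "standard_ordering As A d Vs"
    using TD by (simp_all add: V_def[abs_def] Vs_def[abs_def])
  have ord_d: "standard_ordering A As d Vd"
    using standard_ordering_rev[OF ord] by (simp add: Vd_def[abs_def])
  have proper: "subspace_sum Vs {0..<d} \<noteq> UNIV"
    using primitive_idempotents_proper[of d As Es A] TD ord_s by (simp add: Vs_def[abs_def])
  have pair: "TD_pair A As" and d: "0 < d" using TD assms(4) by auto
  have \<theta>_inj: "inj_on \<theta> {..d}" by (rule eigenvalues_distinct[OF ord V_eig])
  \<comment> \<open>\<theta> is a function of \<mu>, so distinct eigenvalues force distinct
    weights.\<close>
  have \<mu>_inj: "inj_on \<mu> {..d}"
    using \<theta>_inj by (auto simp: inj_on_def \<theta>_def)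
  \<comment> \<open>Reversal inverts \<mu>, so \<open>a = inverse a\<close> would make the first and
    last eigenvalues of \<open>A\<close> equal.\<close>
  have a_sq: "a - inverse a \<noteq> 0"
  proof
    assume "a - inverse a = 0"
    then have "\<theta> d = \<theta> 0" using \<mu>_rev[of 0] \<mu>_nz[of 0] by (simp add: \<theta>_def)
    then show False using \<theta>_inj d by (auto simp: inj_on_def)
  qed
  have ratio: "\<mu> j = q\<^sup>2 * \<mu> (Suc j)" for j
    using nz by (simp add: \<mu>_def flip: power_int_add power_int_numeral)
  have U: "split_U d E Es = (\<lambda>j. subspace_sum Vs {0..j} \<inter> subspace_sum V {j..d})"
    by (simp add: fun_eq_iff split_U_def V_def[abs_def] Vs_def[abs_def])
  have rev: "(\<lambda>k. d - k) ` {j..d} = {0..d - j}" if "j \<le> d" for j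
  proof
    show "{0..d - j} \<subseteq> (\<lambda>k. d - k) ` {j..d}"
    proof
      fix k assume "k \<in> {0..d - j}"
      then show "k \<in> (\<lambda>k. d - k) ` {j..d}"
        using that by (intro image_eqI[of _ _ "d - k"]) auto
    qed
  qed (use that in auto)
  have U_down: "split_U_Down d E Es j = subspace_sum Vs {0..j} \<inter> subspace_sum Vd {j..d}" if "j \<le> d" for j
  proof -
    have "(\<Union>k\<in>{j..d}. Vd k) = (\<Union>k\<in>{0..d - j}. V k)"
      unfolding rev[OF that, symmetric] by (simp add: Vd_def)
    then show ?thesis
      by (simp add: split_U_Down_def subspace_sum_def V_def[abs_def] Vs_def[abs_def])
  qed
  have c_M: "scale (a - inverse a) (?M v) = scale a (K v) - scale (inverse a) (B v)" for v
    using a_sq by (simp add: M_map_def)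
  have weights: "\<theta> j * \<mu> j = a * (\<mu> j * \<mu> j) + inverse a"
      "\<theta>s j * \<mu> j = b * (\<mu> j * \<mu> j) + inverse b"
      "\<theta>d j * \<mu> j = inverse a * (\<mu> j * \<mu> j) + a" for j
    using \<mu>_nz[of j] by (simp_all add: \<theta>_def \<theta>s_def \<theta>d_def algebra_simps)
  interpret up: td_split scale d A As V Vs \<theta> \<theta>s
    by (rule td_split_of_TD_pair[OF pair ord ord_s V_eig Vs_eig proper d])
  interpret dn: td_split scale d A As Vd Vs \<theta>d \<theta>s
    by (rule td_split_of_TD_pair[OF pair ord_d ord_s Vd_eig Vs_eig proper d])
  interpret td_split_pair scale d A As V Vd Vs \<theta> \<theta>d \<theta>s K B \<mu>
    "q\<^sup>2" a "inverse a" b "inverse b" ?M "a - inverse a"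
  proof (intro td_split_pair.intro td_split_weight.intro td_split_weight_axioms.intro
      td_split_pair_axioms.intro up.td_split_axioms dn.td_split_axioms)
    show "endomorphism K" "endomorphism B" using K B by auto
    show "K u = scale (\<mu> j) u" if "j \<le> d" "u \<in> subspace_sum Vs {0..j} \<inter> subspace_sum V {j..d}" for j u
      using K that by (simp add: U \<mu>_def)
    show "B u = scale (\<mu> j) u" if "j \<le> d" "u \<in> subspace_sum Vs {0..j} \<inter> subspace_sum Vd {j..d}" for j u
      using B that by (simp add: U_down \<mu>_def)
    show "endomorphism ?M"
      using K B by (auto simp: Vector_Spaces.linear_iff M_map_def algebra_simps)
    show "\<mu> j = q\<^sup>2 * \<mu> (Suc j)" "\<mu> j = q\<^sup>2 * \<mu> (Suc j)" for j by (rule ratio)+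
    show "\<theta>s j * \<mu> j = b * (\<mu> j * \<mu> j) + inverse b"
      "\<theta>s j * \<mu> j = b * (\<mu> j * \<mu> j) + inverse b" for j by (rule weights)+
  qed (use \<mu>_nz \<mu>_inj nz a_sq c_M weights in simp_all)
  \<comment> \<open>\<open>U_down\<close> holds only for indices up to \<open>d\<close>, so the two
    sequences are compared at the relevant index rather than as functions.\<close>
  have pred: "pred_term (split_U_Down d E Es) i
      = pred_term (\<lambda>j. subspace_sum Vs {0..j} \<inter> subspace_sum Vd {j..d}) i"
    using assms(8) by (simp add: pred_term_def U_down)
  show ?thesis
    unfolding \<mu>_inv[symmetric] pred U U_down[OF assms(8)]
    by (intro conjI image_subsetI inv_M_lowers assms(8))
qed

end
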